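(* Let $X \xrightarrow{f} Z \xleftarrow{g} Y$ be continuous maps. Then $$\mathrm{TC}(f,g)=\mathrm{TC}(g,f).$$
   Context: All maps are continuous, $I=[0,1]$, and path spaces $X^I$ carry the compact-open topology. For a map $p\colon E\to B$, the sectional number $\mathrm{sec}(p)$ is the least integer $k\ge 0$ such that $B$ has an open cover $U_0,\dots,U_k$ with continuous maps $s_i\colon U_i\to E$ satisfying $p\circ s_i=\mathrm{inc}_{U_i}$ (strict equality); $\mathrm{sec}(p)=\infty$ if no such $k$ exists. For maps $f\colon X\to Z$, $g\colon Y\to Z$ put $\Delta^I_{f,g}=\{(\alpha,\beta)\in X^I\times Y^I : f\circ\alpha=g\circ\beta\}$ and $\pi_{f,g}\colon\Delta^I_{f,g}\to X\times Y$, $\pi_{f,g}(\alpha,\beta)=(\alpha(0),\beta(1))$. The bivariate topological complexity is $\mathrm{TC}(f,g):=\mathrm{sec}(\pi_{f,g})$. *)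

theory Defs
  imports "HOL-Analysis.Analysis" "HOL-Library.Extended_Nat"
begin

text \<open>
  A continuous map between the topologies \<open>X\<close> and \<open>Y\<close> is represented by a total function, which is
  made unique by requiring it to be \<open>undefined\<close> outside \<open>topspace X\<close>.
\<close>

definition continuous_maps :: "'a topology \<Rightarrow> 'b topology \<Rightarrow> ('a \<Rightarrow> 'b) set" where
  "continuous_maps X Y = {h. continuous_map X Y h \<and> h \<in> extensional (topspace X)}"

definition compact_open_topology :: "'a topology \<Rightarrow> 'b topology \<Rightarrow> ('a \<Rightarrow> 'b) topology" where
  "compact_open_topology X Y =
     topology_generated_by
       {{h \<in> continuous_maps X Y. h ` K \<subseteq> U} | K U. compactin X K \<and> openin Y U}"

lemma topspace_compact_open_topology [simp]:
  "topspace (compact_open_topology X Y) = continuous_maps X Y"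
proof -
  have "continuous_maps X Y \<in>
      {{h \<in> continuous_maps X Y. h ` K \<subseteq> U} | K U. compactin X K \<and> openin Y U}"
    by (intro CollectI exI[of _ "{}"]) auto
  then show ?thesis
    unfolding compact_open_topology_def topology_generated_by_topspace by blast
qed

definition path_space :: "'a topology \<Rightarrow> (real \<Rightarrow> 'a) topology" where
  "path_space X = compact_open_topology (top_of_set {0..1}) X"

definition has_local_sections ::
  "'e topology \<Rightarrow> 'b topology \<Rightarrow> ('e \<Rightarrow> 'b) \<Rightarrow> nat \<Rightarrow> bool" where
  "has_local_sections E B p k \<longleftrightarrow>
     (\<exists>(U :: nat \<Rightarrow> 'b set) (s :: nat \<Rightarrow> 'b \<Rightarrow> 'e).
        (\<forall>i\<le>k. openin B (U i)) \<and>
        (\<Union>i\<le>k. U i) = topspace B \<and>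
        (\<forall>i\<le>k. continuous_map (subtopology B (U i)) E (s i) \<and> (\<forall>b\<in>U i. p (s i b) = b)))"

text \<open>
  The infimum is taken in \<open>enat\<close>: it is a minimum if some \<open>k\<close> is admissible, and \<open>\<infinity>\<close> otherwise.
\<close>

definition sectional_number :: "'e topology \<Rightarrow> 'b topology \<Rightarrow> ('e \<Rightarrow> 'b) \<Rightarrow> enat" where
  "sectional_number E B p = (INF k \<in> {k. has_local_sections E B p k}. enat k)"

definition Delta_paths ::
  "'a topology \<Rightarrow> 'b topology \<Rightarrow> ('a \<Rightarrow> 'c) \<Rightarrow> ('b \<Rightarrow> 'c) \<Rightarrow>
    ((real \<Rightarrow> 'a) \<times> (real \<Rightarrow> 'b)) topology" where
  "Delta_paths X Y f g =
     subtopology (prod_topology (path_space X) (path_space Y))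
       {(\<alpha>, \<beta>). \<forall>t\<in>{0..1}. f (\<alpha> t) = g (\<beta> t)}"

text \<open>
  As a bare function this projection does not depend on \<open>f\<close> and \<open>g\<close>; only its domain,
  \<open>Delta_paths X Y f g\<close>, does.
\<close>

definition endpoints :: "(real \<Rightarrow> 'a) \<times> (real \<Rightarrow> 'b) \<Rightarrow> 'a \<times> 'b" where
  "endpoints = (\<lambda>(\<alpha>, \<beta>). (\<alpha> 0, \<beta> 1))"

definition bivariate_TC ::
  "'a topology \<Rightarrow> 'b topology \<Rightarrow> ('a \<Rightarrow> 'c) \<Rightarrow> ('b \<Rightarrow> 'c) \<Rightarrow> enat" where
  "bivariate_TC X Y f g =
     sectional_number (Delta_paths X Y f g) (prod_topology X Y) endpoints"

end

theory Submission
  imports Defs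
begin

text \<open>
  Path reversal composed with the exchange of factors, \<open>(\<alpha>, \<beta>) \<mapsto> (\<beta>\<^sup>-, \<alpha>\<^sup>-)\<close> with
  \<open>\<gamma>\<^sup>-(t) = \<gamma>(1 - t)\<close>, maps the space of pairs with \<open>f \<circ> \<alpha> = g \<circ> \<beta>\<close> continuously into the
  corresponding space for \<open>(g, f)\<close>. Since \<open>(\<beta>\<^sup>-(0), \<alpha>\<^sup>-(1)) = (\<beta>(1), \<alpha>(0))\<close>, it covers the coordinate
  exchange \<open>X \<times> Y \<rightarrow> Y \<times> X\<close>, which is a homeomorphism. Hence every cover of \<open>X \<times> Y\<close> by open sets
  with local sections is carried to such a cover of \<open>Y \<times> X\<close>
  (\<open>has_local_sections_transfer\<close>), and conversely by symmetry. The two sets of admissible \<open>k\<close>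
  agree, and so do their infima. Continuity of the reversal is a case of the continuity of
  precomposition in the compact-open topology
  (\<open>continuous_map_precompose_compact_open\<close>).
\<close>

text \<open>
  The restriction to \<open>topspace S\<close> returns the composite to its representative that is
  \<open>undefined\<close> outside \<open>topspace S\<close>.
\<close>

lemma continuous_map_precompose_compact_open:
  assumes r: "continuous_map S T r"
  shows "continuous_map (compact_open_topology T X) (compact_open_topology S X)
           (\<lambda>h. restrict (h \<circ> r) (topspace S))"
    (is "continuous_map _ _ ?R")
proof -
  have maps: "?R h \<in> continuous_maps S X" if "h \<in> continuous_maps T X" for h
  proof -
    have "continuous_map S X (h \<circ> r)"
      using that r continuous_map_compose unfolding continuous_maps_def by blast
    then have "continuous_map S X (?R h)"
      by (rule continuous_map_eq) simp
    then show ?thesis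
      by (simp add: continuous_maps_def)
  qed
  let ?B = "{{h \<in> continuous_maps S X. h ` K \<subseteq> U} | K U. compactin S K \<and> openin X U}"
  have "continuous_map (compact_open_topology T X) (topology_generated_by ?B) ?R"
  proof (rule continuous_on_generated_topo)
    fix V assume "V \<in> ?B"
    then obtain K U where V: "V = {h \<in> continuous_maps S X. h ` K \<subseteq> U}"
      and K: "compactin S K" and U: "openin X U"
      by blast
    have "?R h ` K = h ` r ` K" for h
      using compactin_subset_topspace[OF K] by (auto simp: image_iff subset_iff)
    then have "?R -` V \<inter> topspace (compact_open_topology T X)
        = {h \<in> continuous_maps T X. h ` r ` K \<subseteq> U}"
      using maps unfolding V by auto
    moreover have "compactin T (r ` K)"
      using K r by (rule image_compactin)
    ultimately show "openin (compact_open_topology T X)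
        (?R -` V \<inter> topspace (compact_open_topology T X))"
      using U unfolding compact_open_topology_def
      by (auto intro!: topology_generated_by_Basis)
  next
    have "\<Union> ?B = continuous_maps S X"
      using topspace_compact_open_topology[of S X]
      unfolding compact_open_topology_def topology_generated_by_topspace .
    then show "?R ` topspace (compact_open_topology T X) \<subseteq> \<Union> ?B"
      using maps by auto
  qed
  then show ?thesis
    by (simp add: compact_open_topology_def[of S X])
qed

text \<open>The reverse of a path on \<open>[0,1]\<close>, again \<open>undefined\<close> outside the interval.\<close>

definition reverse_path :: "(real \<Rightarrow> 'a) \<Rightarrow> real \<Rightarrow> 'a" where
  "reverse_path \<alpha> = restrict (\<lambda>t. \<alpha> (1 - t)) {0..1}"

lemma continuous_map_reverse_path:
  "continuous_map (path_space X) (path_space X) reverse_path"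
proof -
  have "continuous_map (top_of_set {0..1}) (top_of_set {0..1}) (\<lambda>t::real. 1 - t)"
    by (auto intro!: continuous_intros)
  from continuous_map_precompose_compact_open[OF this, of X] show ?thesis
    by (simp add: path_space_def reverse_path_def[abs_def] comp_def)
qed

text \<open>
  Both paths are reversed and exchanged; exchange alone would send the pair of endpoints
  \<open>(\<alpha>(0), \<beta>(1))\<close> to \<open>(\<beta>(0), \<alpha>(1))\<close>.
\<close>

definition reverse_swap :: "(real \<Rightarrow> 'a) \<times> (real \<Rightarrow> 'b) \<Rightarrow> (real \<Rightarrow> 'b) \<times> (real \<Rightarrow> 'a)" where
  "reverse_swap = (\<lambda>(\<alpha>, \<beta>). (reverse_path \<beta>, reverse_path \<alpha>))"

lemma endpoints_reverse_swap: "endpoints (reverse_swap w) = prod.swap (endpoints w)"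
  by (cases w) (simp add: endpoints_def reverse_swap_def reverse_path_def)

lemma continuous_map_reverse_swap:
  "continuous_map (Delta_paths X Y f g) (Delta_paths Y X g f) reverse_swap"
proof -
  have "continuous_map (prod_topology (path_space X) (path_space Y))
      (prod_topology (path_space Y) (path_space X))
      (\<lambda>w. (reverse_path (snd w), reverse_path (fst w)))"
    by (intro continuous_map_pairedI
        continuous_map_compose[OF continuous_map_fst continuous_map_reverse_path, unfolded comp_def]
        continuous_map_compose[OF continuous_map_snd continuous_map_reverse_path, unfolded comp_def])
  then have "continuous_map (prod_topology (path_space X) (path_space Y))
      (prod_topology (path_space Y) (path_space X)) reverse_swap"
    by (simp add: reverse_swap_def case_prod_beta')
  then show ?thesis
    unfolding Delta_paths_def
    by (intro continuous_map_into_subtopology continuous_map_from_subtopology)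
      (auto simp: reverse_swap_def reverse_path_def)
qed

text \<open>
  Local sections of \<open>p\<close> pass to \<open>p'\<close> along a map \<open>\<Phi>\<close> that covers \<open>\<phi>\<close>, when \<open>\<phi>\<close> has a
  continuous right inverse \<open>\<psi>\<close>: pull the cover back along \<open>\<psi>\<close> and use \<open>\<Phi> \<circ> s \<circ> \<psi>\<close>.
\<close>

lemma has_local_sections_transfer:
  assumes sec: "has_local_sections E B p k"
    and \<Phi>: "continuous_map E E' \<Phi>"
    and \<psi>: "continuous_map B' B \<psi>"
    and cover: "\<And>e. e \<in> topspace E \<Longrightarrow> p' (\<Phi> e) = \<phi> (p e)"
    and inv: "\<And>b. b \<in> topspace B' \<Longrightarrow> \<phi> (\<psi> b) = b"
  shows "has_local_sections E' B' p' k"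
proof -
  obtain U s where U: "\<And>i. i \<le> k \<Longrightarrow> openin B (U i)"
    and Un: "(\<Union>i\<le>k. U i) = topspace B"
    and s: "\<And>i. i \<le> k \<Longrightarrow> continuous_map (subtopology B (U i)) E (s i)"
    and ps: "\<And>i b. i \<le> k \<Longrightarrow> b \<in> U i \<Longrightarrow> p (s i b) = b"
    using sec unfolding has_local_sections_def by metis
  define U' where "U' i = {b \<in> topspace B'. \<psi> b \<in> U i}" for i
  define s' where "s' i = \<Phi> \<circ> (s i \<circ> \<psi>)" for i
  have "openin B' (U' i)" if "i \<le> k" for i
    using openin_continuous_map_preimage[OF \<psi> U[OF that]] by (simp add: U'_def)
  moreover have "(\<Union>i\<le>k. U' i) = topspace B'"
  proof -
    have "\<psi> b \<in> (\<Union>i\<le>k. U i)" if "b \<in> topspace B'" for b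
      using \<psi> that Un by (auto simp: continuous_map_def)
    then show ?thesis
      by (auto simp: U'_def)
  qed
  moreover have "continuous_map (subtopology B' (U' i)) E' (s' i)" if "i \<le> k" for i
  proof -
    have "continuous_map (subtopology B' (U' i)) (subtopology B (U i)) \<psi>"
      by (intro continuous_map_into_subtopology continuous_map_from_subtopology \<psi>)
        (auto simp: U'_def)
    then show ?thesis
      unfolding s'_def using s[OF that] \<Phi> by (intro continuous_map_compose)
  qed
  moreover have "p' (s' i b) = b" if "i \<le> k" "b \<in> U' i" for i b
  proof -
    have b: "b \<in> topspace B'" "\<psi> b \<in> U i"
      using that by (auto simp: U'_def)
    then have "\<psi> b \<in> topspace (subtopology B (U i))"
      using openin_subset[OF U[OF that(1)]] by auto
    then have "s i (\<psi> b) \<in> topspace E"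
      using s[OF that(1)] by (auto simp: continuous_map_def)
    then show ?thesis
      using cover ps[OF that(1) b(2)] inv[OF b(1)] by (simp add: s'_def)
  qed
  ultimately show ?thesis
    unfolding has_local_sections_def by blast
qed

lemma has_local_sections_Delta_paths_swap:
  assumes "has_local_sections (Delta_paths X Y f g) (prod_topology X Y) endpoints k"
  shows "has_local_sections (Delta_paths Y X g f) (prod_topology Y X) endpoints k"
proof (rule has_local_sections_transfer[OF assms continuous_map_reverse_swap,
      where \<phi> = prod.swap])
  show "continuous_map (prod_topology Y X) (prod_topology X Y) prod.swap"
    by (simp add: prod.swap_def[abs_def] continuous_map_pairedI continuous_map_fst
        continuous_map_snd)
qed (simp_all add: endpoints_reverse_swap)

theorem proposition2p13:
  fixes X :: "'a topology" and Y :: "'b topology" and Z :: "'c topology"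
    and f :: "'a \<Rightarrow> 'c" and g :: "'b \<Rightarrow> 'c"
  assumes "continuous_map X Z f" and "continuous_map Y Z g"
  shows "bivariate_TC X Y f g = bivariate_TC Y X g f"
proof -
  have "{k. has_local_sections (Delta_paths X Y f g) (prod_topology X Y) endpoints k}
      = {k. has_local_sections (Delta_paths Y X g f) (prod_topology Y X) endpoints k}"
    by (intro Collect_cong iffI) (rule has_local_sections_Delta_paths_swap, assumption)+
  then show ?thesis
    by (simp add: bivariate_TC_def sectional_number_def)
qed

end
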